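(* Suppose that $\alpha\in[0,n)$, $p\in(1,\frac n\alpha)$, and $q\in(1,\infty)$ satisfy $\frac1q=\frac1p-\frac\alpha n$. If there exist $r,s\in(0,\infty)$ and a constant $C\in(0,\infty)$ such that, for any $w\in A^{\mathrm{loc}}_{p,q}(r)$ and $f\in L^p(w^{\frac pq})$, $$\left\|M_{\alpha,r}f\right\|_{L^q(w)}\le C\,[w]^s_{A^{\mathrm{loc}}_{p,q}(r)}\left\|f\right\|_{L^p(w^{\frac pq})},$$ then $s\ge\left(1-\frac\alpha n\right)\frac{p'}q$.
   Context: The underlying space is $\mathbb{R}^n$; cubes have edges parallel to the coordinate axes; $\ell(Q)$ is the edge length of $Q$; $\fint_Qf:=\frac1{|Q|}\int_Qf$; $p':=\frac p{p-1}$; $\frac n\alpha:=\infty$ if $\alpha=0$. A scalar weight is a non-negative locally integrable function on $\mathbb{R}^n$ taking values in $(0,\infty)$ almost everywhere. $A^{\mathrm{loc}}_{p,q}(r)$ is the set of all scalar weights $w$ with $$[w]_{A^{\mathrm{loc}}_{p,q}(r)}:=\sup_{\mathrm{cubes}\ Q:\ \ell(Q)\le r}\fint_Qw(x)\,dx\left\{\fint_Q[w(x)]^{-\frac{p'}q}\,dx\right\}^{\frac q{p'}}<\infty.$$ For $\sigma\in(1,\infty)$ and a scalar weight $u$, $\|f\|_{L^\sigma(u)}:=[\int_{\mathbb{R}^n}|f(x)|^\sigma u(x)\,dx]^{1/\sigma}$. The scalar local fractional maximal operator is $$M_{\alpha,r}f(x):=\sup_{Q\ni x,\ \ell(Q)\le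 r}\frac1{|Q|^{1-\frac\alpha n}}\int_Q|f(y)|\,dy,$$ the supremum being over all cubes $Q$ containing $x$ with $\ell(Q)\le r$. *)

theory Defs
  imports "HOL-Analysis.Analysis"
begin

text \<open>
  Powers of extended non-negative numbers. Used only for exponents \<open>t > 0\<close>, where
  \<open>0\<close> goes to \<open>0\<close> and \<open>\<infinity>\<close> goes to \<open>\<infinity>\<close>.
\<close>

definition epowr :: "ennreal \<Rightarrow> real \<Rightarrow> ennreal" where
  "epowr x t = (if x = top then top else ennreal (enn2real x powr t))"

definition conj_exponent :: "real \<Rightarrow> real" where
  "conj_exponent p = p / (p - 1)"

text \<open>
  The closed cube with lower corner \<open>a\<close> and edge length \<open>l\<close>. A supremum over all cubes
  \<open>Q\<close> with \<open>\<ell>(Q) \<le> r\<close> is a supremum over all pairs \<open>(a, l)\<close> with \<open>0 < l \<le> r\<close>.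
\<close>

definition cube :: "real ^ 'n \<Rightarrow> real \<Rightarrow> (real ^ 'n) set" where
  "cube a l = cbox a (\<chi> i. a $ i + l)"

definition average :: "(real ^ 'n) set \<Rightarrow> (real ^ 'n \<Rightarrow> ennreal) \<Rightarrow> ennreal" where
  "average Q g = (\<integral>\<^sup>+ x\<in>Q. g x \<partial>lebesgue) / emeasure lebesgue Q"

definition locally_integrable :: "(real ^ 'n \<Rightarrow> real) \<Rightarrow> bool" where
  "locally_integrable w \<longleftrightarrow> (\<forall>K. compact K \<longrightarrow> set_integrable lebesgue K w)"

text \<open>
  A weight is finite almost everywhere, so it is represented by a real-valued function; only
  its values on a null set are affected.
\<close>

definition scalar_weight :: "(real ^ 'n \<Rightarrow> real) \<Rightarrow> bool" where
  "scalar_weight w \<longleftrightarrow>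
     (\<forall>x. 0 \<le> w x) \<and> locally_integrable w \<and> (AE x in lebesgue. 0 < w x)"

text \<open>
  The negative power \<open>w x powr - (p' / q)\<close> is \<open>0\<close>, not \<open>\<infinity>\<close>, where \<open>w x = 0\<close>; for a weight
  this is a null set.
\<close>

definition Aloc_const :: "real \<Rightarrow> real \<Rightarrow> real \<Rightarrow> (real ^ 'n \<Rightarrow> real) \<Rightarrow> ennreal" where
  "Aloc_const p q r w =
     (SUP (a, l) \<in> {(a, l). 0 < l \<and> l \<le> r}.
        average (cube a l) (\<lambda>x. ennreal (w x)) *
        epowr (average (cube a l) (\<lambda>x. ennreal (w x powr (- (conj_exponent p / q)))))
              (q / conj_exponent p))"

definition Aloc :: "real \<Rightarrow> real \<Rightarrow> real \<Rightarrow> (real ^ 'n \<Rightarrow> real) set" where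
  "Aloc p q r = {w. scalar_weight w \<and> Aloc_const p q r w < top}"

text \<open>
  The norm takes the absolute value of the function as its argument, so that it also applies to
  maximal functions, which may take the value \<open>\<infinity>\<close>.
\<close>

definition weighted_norm ::
    "real \<Rightarrow> (real ^ 'n \<Rightarrow> real) \<Rightarrow> (real ^ 'n \<Rightarrow> ennreal) \<Rightarrow> ennreal" where
  "weighted_norm \<sigma> u g = epowr (\<integral>\<^sup>+ x. epowr (g x) \<sigma> * ennreal (u x) \<partial>lebesgue) (1 / \<sigma>)"

definition weighted_Lp :: "real \<Rightarrow> (real ^ 'n \<Rightarrow> real) \<Rightarrow> (real ^ 'n \<Rightarrow> real) set" where
  "weighted_Lp \<sigma> u =
     {f \<in> borel_measurable lebesgue. weighted_norm \<sigma> u (\<lambda>x. ennreal \<bar>f x\<bar>) < top}"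

definition loc_frac_maximal ::
    "real \<Rightarrow> real \<Rightarrow> (real ^ 'n \<Rightarrow> real) \<Rightarrow> real ^ 'n \<Rightarrow> ennreal" where
  "loc_frac_maximal \<alpha> r f x =
     (SUP (a, l) \<in> {(a, l). 0 < l \<and> l \<le> r \<and> x \<in> cube a l}.
        (\<integral>\<^sup>+ y\<in>cube a l. ennreal \<bar>f y\<bar> \<partial>lebesgue) /
        epowr (emeasure lebesgue (cube a l)) (1 - \<alpha> / real CARD('n)))"

end

theory Submission
  imports Defs
begin

text \<open>
  The exponent is forced by power weights. Write \<open>|x|\<close> for the supremum norm (\<open>infnorm\<close>), whose
  closed balls are exactly the cubes, put \<open>\<kappa> = p' / q\<close> and \<open>R = r / 2\<close>, and for \<open>0 < \<delta> < 1\<close> take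
  \<open>w x = |x| powr ((n - \<delta>) / \<kappa>)\<close> and \<open>f x = |x| powr (\<delta> - n)\<close> for \<open>|x| \<le> R\<close>, \<open>f x = 0\<close> otherwise.
  The dual weight \<open>w powr (- \<kappa>)\<close> is \<open>|x| powr (\<delta> - n)\<close>, which is only barely integrable at the
  origin. All integrals reduce to the exact formula
  \<open>\<integral>\<^bsub>|x| \<le> t\<^esub> |x| powr (\<beta> - n) dx = n 2^n t powr \<beta> / \<beta>\<close> (lemma \<open>nn_integral_infnorm_powr\<close>), and give

  \<^item> \<open>[w] \<le> (n 3^n / \<delta>) powr (1 / \<kappa>)\<close> (lemma \<open>Aloc_const_infnorm_powr_le\<close>);

  \<^item> the norm of \<open>f\<close> in \<open>L^p(w powr (p / q))\<close> is a constant times \<open>R powr (\<delta> / p) \<delta> powr (- 1 / p)\<close>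
    (lemma \<open>weighted_norm_infnorm_powr\<close>);

  \<^item> testing the maximal function at \<open>x\<close> on the cube centred at the origin with \<open>x\<close> on its boundary
    gains a factor \<open>1 / \<delta>\<close>, so the norm of the maximal function in \<open>L^q(w)\<close> is at least a constant
    times \<open>R powr (\<delta> / p) \<delta> powr (- 1 - 1 / q)\<close> (lemma \<open>weighted_norm_loc_frac_maximal_ge\<close>).

  The powers of \<open>R\<close> cancel, so the assumed inequality bounds \<open>\<delta> powr (- 1 - 1 / q)\<close> by a constant
  times \<open>\<delta> powr (- s / \<kappa> - 1 / p)\<close>. Letting \<open>\<delta>\<close> tend to \<open>0\<close> yields
  \<open>s / \<kappa> \<ge> 1 + 1 / q - 1 / p = 1 - \<alpha> / n\<close>.

  Since \<open>0 powr t = 0\<close> for every \<open>t\<close>, the functions \<open>w\<close>, \<open>w powr (- \<kappa>)\<close> and \<open>f\<close> vanish at the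
  origin, and the identities between these powers hold there as well.
\<close>

section \<open>Integrals of powers of the supremum norm\<close>

lemma infnorm_le_iff_cart: "infnorm (x :: real ^ 'n) \<le> t \<longleftrightarrow> (\<forall>i. \<bar>x $ i\<bar> \<le> t)"
proof
  assume "infnorm x \<le> t"
  then show "\<forall>i. \<bar>x $ i\<bar> \<le> t"
    using component_le_infnorm_cart[of x] order_trans by blast
next
  assume "\<forall>i. \<bar>x $ i\<bar> \<le> t"
  then show "infnorm x \<le> t"
    unfolding infnorm_cart by (intro cSup_least) auto
qed

lemma cube_eq_infnorm_ball:
  "cube a l = {x :: real ^ 'n. infnorm (x - (\<chi> i. a $ i + l / 2)) \<le> l / 2}"
  unfolding cube_def set_eq_iff mem_box_cart mem_Collect_eq infnorm_le_iff_cart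
  by (intro allI iff_allI) (auto simp: abs_le_iff field_simps)

lemma infnorm_ball_eq_cube:
  "{x :: real ^ 'n. infnorm x \<le> t} = cube (\<chi> i. - t) (2 * t)"
  by (subst cube_eq_infnorm_ball) (simp add: zero_vec_def[symmetric])

lemma emeasure_lborel_cube:
  assumes "0 \<le> l"
  shows "emeasure lborel (cube (a :: real ^ 'n) l) = ennreal (l ^ CARD('n))"
proof -
  have "cube a l \<noteq> {}"
    using assms by (auto simp: cube_def interval_ne_empty_cart)
  then have "measure lborel (cube a l) = l ^ CARD('n)"
    unfolding cube_def using content_cbox_cart[of a "\<chi> i. a $ i + l"] by simp
  moreover have "emeasure lborel (cube a l) = ennreal (measure lborel (cube a l))"
    unfolding cube_def using emeasure_lborel_cbox_finite[of a "\<chi> i. a $ i + l"]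
    by (intro emeasure_eq_ennreal_measure) auto
  ultimately show ?thesis by simp
qed

lemma borel_measurable_infnorm [measurable]:
  "(infnorm :: 'a :: euclidean_space \<Rightarrow> real) \<in> borel_measurable borel"
  by (intro borel_measurable_continuous_onI continuous_on_infnorm continuous_on_id)

text \<open>
  Polar coordinates for the supremum norm: since the ball of radius \<open>\<rho>\<close> has volume \<open>(2 \<rho>)^n\<close>, the
  image of Lebesgue measure under the norm has density \<open>n 2^n \<rho>^(n - 1)\<close>. The restriction to a
  ball makes the measures finite, so that they are determined by their values on half-lines.
\<close>

lemma distr_infnorm:
  assumes "0 < R"
  shows "distr (density lborel (\<lambda>x :: real ^ 'n. indicator {x. infnorm x \<le> R} x)) borel infnorm =
         density lborel (\<lambda>\<rho>. ennreal (real CARD('n) * 2 ^ CARD('n) * \<rho> ^ (CARD('n) - 1))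
                              * indicator {0..R} \<rho>)"
    (is "?M = ?N")
proof (rule measure_eqI_lessThan)
  let ?n = "CARD('n)"
  have ball: "emeasure lborel {x :: real ^ 'n. infnorm x \<le> t} = ennreal ((2 * t) ^ ?n)"
    if "0 \<le> t" for t
    using that by (simp add: infnorm_ball_eq_cube emeasure_lborel_cube)
  have M: "emeasure ?M {t<..} = emeasure lborel {x :: real ^ 'n. infnorm x \<le> R \<and> t < infnorm x}" for t
    by (simp add: emeasure_distr emeasure_density indicator_inter_arith[symmetric] vimage_def
        Collect_conj_eq)
  have M_eq: "emeasure ?M {t<..} =
      (if R \<le> t then 0 else ennreal ((2 * R) ^ ?n - (2 * max 0 t) ^ ?n))" for t
  proof -
    consider "R \<le> t" | "0 \<le> t" "t < R" | "t < 0" by linarith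
    then show ?thesis
    proof cases
      case 1
      then have "{x :: real ^ 'n. infnorm x \<le> R \<and> t < infnorm x} = {}" by auto
      then have "emeasure ?M {t<..} = 0" unfolding M by (simp only: emeasure_empty)
      with 1 show ?thesis by simp
    next
      case 2
      have "{x :: real ^ 'n. infnorm x \<le> R \<and> t < infnorm x}
          = {x. infnorm x \<le> R} - {x. infnorm x \<le> t}" by auto
      moreover have "emeasure lborel \<dots> = ennreal ((2 * R) ^ ?n) - ennreal ((2 * t) ^ ?n)"
        using 2 ball[of R] ball[of t] by (subst emeasure_Diff) auto
      ultimately have "emeasure ?M {t<..} = ennreal ((2 * R) ^ ?n) - ennreal ((2 * t) ^ ?n)"
        unfolding M by simp
      with 2 show ?thesis
        by (simp add: ennreal_minus)
    next
      case 3
      then have "{x :: real ^ 'n. infnorm x \<le> R \<and> t < infnorm x} = {x. infnorm x \<le> R}"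
        by (auto intro: less_le_trans infnorm_pos_le)
      then have "emeasure ?M {t<..} = ennreal ((2 * R) ^ ?n)"
        unfolding M using ball[of R] assms by simp
      with 3 assms show ?thesis by (simp add: max_def power_0_left)
    qed
  qed
  show "emeasure ?M {t<..} < \<infinity>" for t
    unfolding M_eq by simp
  show "emeasure ?M {t<..} = emeasure ?N {t<..}" for t
  proof (cases "R \<le> t")
    case True
    then have "emeasure ?N {t<..} = (\<integral>\<^sup>+\<rho>. 0 \<partial>(lborel :: real measure))"
      by (subst emeasure_density, measurable, intro nn_integral_cong) (auto simp: indicator_def)
    with True show ?thesis
      unfolding M_eq by simp
  next
    case False
    define u where "u = max 0 t"
    have u: "0 \<le> u" "u \<le> R" using False assms by (auto simp: u_def)
    have "emeasure ?N {t<..} = (\<integral>\<^sup>+\<rho>. ennreal (real ?n * 2 ^ ?n * \<rho> ^ (?n - 1)) *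
             indicator {0..R} \<rho> * indicator {t<..} \<rho> \<partial>lborel)"
      by (simp add: emeasure_density)
    \<comment> \<open>The two domains of integration differ at most in the single point \<open>u\<close>.\<close>
    also have "\<dots> = (\<integral>\<^sup>+\<rho>. ennreal (real ?n * 2 ^ ?n * \<rho> ^ (?n - 1)) * indicator {u..R} \<rho> \<partial>lborel)"
      by (rule nn_integral_cong_AE, rule AE_mp[OF AE_lborel_singleton[of u]])
        (auto intro!: AE_I2 simp: indicator_def u_def)
    also have "\<dots> = ennreal ((2 * R) ^ ?n - (2 * u) ^ ?n)"
    proof (rule nn_integral_FTC_Icc)
      fix x
      show "DERIV (\<lambda>\<rho>. (2 * \<rho>) ^ ?n) x :> real ?n * 2 ^ ?n * x ^ (?n - 1)"
        using DERIV_power[OF DERIV_cmult_Id[of "2 :: real" x UNIV], of ?n]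
        by (cases ?n) (auto simp: power_mult_distrib mult_ac)
    qed (use u in auto)
    finally show ?thesis
      using False unfolding M_eq by (simp add: u_def)
  qed
qed auto

lemma nn_integral_infnorm_powr:
  assumes "0 < R" "0 < \<beta>"
  shows "(\<integral>\<^sup>+ x \<in> {x :: real ^ 'n. infnorm x \<le> R}.
            ennreal (infnorm x powr (\<beta> - real CARD('n))) \<partial>lebesgue)
       = ennreal (real CARD('n) * 2 ^ CARD('n) * (R powr \<beta> / \<beta>))"
proof -
  let ?n = "CARD('n)"
  let ?h = "\<lambda>\<rho>. ennreal (\<rho> powr (\<beta> - real ?n))"
  have "(\<integral>\<^sup>+ x \<in> {x :: real ^ 'n. infnorm x \<le> R}. ?h (infnorm x) \<partial>lebesgue)
      = (\<integral>\<^sup>+ x. ?h (infnorm x) \<partial>density lborel (\<lambda>x :: real ^ 'n. indicator {x. infnorm x \<le> R} x))"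
    by (simp add: nn_integral_completion nn_integral_density mult.commute)
  also have "\<dots> = (\<integral>\<^sup>+ \<rho>. ?h \<rho>
      \<partial>distr (density lborel (\<lambda>x :: real ^ 'n. indicator {x. infnorm x \<le> R} x)) borel infnorm)"
    by (simp add: nn_integral_distr)
  also have "\<dots> = (\<integral>\<^sup>+ \<rho>. ennreal (real ?n * 2 ^ ?n * \<rho> ^ (?n - 1)) * indicator {0..R} \<rho> * ?h \<rho> \<partial>lborel)"
    unfolding distr_infnorm[OF assms(1)] by (simp add: nn_integral_density)
  also have "\<dots> = (\<integral>\<^sup>+ \<rho>. ennreal (real ?n * 2 ^ ?n * \<rho> powr (\<beta> - 1)) * indicator {0..R} \<rho> \<partial>lborel)"
  proof (rule nn_integral_cong)
    fix \<rho> :: real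
    show "ennreal (real ?n * 2 ^ ?n * \<rho> ^ (?n - 1)) * indicator {0..R} \<rho> * ?h \<rho>
        = ennreal (real ?n * 2 ^ ?n * \<rho> powr (\<beta> - 1)) * indicator {0..R} \<rho>"
    proof (cases "0 < \<rho>")
      case True
      have "\<rho> ^ (?n - 1) * \<rho> powr (\<beta> - real ?n) = \<rho> powr (\<beta> - 1)"
        using True by (simp add: powr_realpow[symmetric] powr_add[symmetric] of_nat_diff Suc_leI)
      then show ?thesis
        using True by (auto simp: indicator_def ennreal_mult'[symmetric] mult.assoc)
    qed (auto simp: indicator_def)
  qed
  also have "\<dots> = ennreal (real ?n * 2 ^ ?n * (R powr \<beta> / \<beta>))"
    using has_integral_mult_right[OF has_integral_powr_from_0[of "\<beta> - 1" R], of "real ?n * 2 ^ ?n"] assms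
    by (intro nn_integral_has_integral_lebesgue') auto
  finally show ?thesis .
qed


section \<open>The weight constant of a power weight\<close>

lemma epowr_ennreal: "0 \<le> x \<Longrightarrow> epowr (ennreal x) t = ennreal (x powr t)"
  by (simp add: epowr_def)

lemma epowr_0: "epowr 0 t = 0"
  by (simp add: epowr_def)

lemma epowr_mono:
  assumes "x \<le> y" "0 \<le> t"
  shows "epowr x t \<le> epowr y t"
proof (cases "y = top")
  case False
  then have "x \<noteq> top" "enn2real x \<le> enn2real y"
    using assms by (auto simp: top_unique less_top intro: enn2real_mono)
  with False assms show ?thesis
    by (auto simp: epowr_def intro!: ennreal_leI powr_mono2)
qed (simp add: epowr_def)

lemma average_cube_le:
  assumes "0 < l" and le: "\<And>x. x \<in> cube a l \<Longrightarrow> g x \<le> c"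
  shows "average (cube (a :: real ^ 'n) l) g \<le> c"
proof -
  have [measurable]: "cube a l \<in> sets lebesgue" by (simp add: cube_def)
  have E: "emeasure lebesgue (cube a l) = ennreal (l ^ CARD('n))"
    using assms(1) by (simp add: cube_def emeasure_lborel_cube[unfolded cube_def])
  have "(\<integral>\<^sup>+ x\<in>cube a l. g x \<partial>lebesgue) \<le> (\<integral>\<^sup>+ x\<in>cube a l. c \<partial>lebesgue)"
    by (intro nn_integral_mono) (auto simp: indicator_def le)
  also have "\<dots> = c * emeasure lebesgue (cube a l)"
    by (simp add: nn_integral_cmult_indicator)
  finally have "average (cube a l) g \<le> c * emeasure lebesgue (cube a l) / emeasure lebesgue (cube a l)"
    unfolding average_def by (rule divide_right_mono_ennreal)
  also have "\<dots> = c"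
    using assms(1) unfolding E ennreal_times_divide[symmetric]
    by (subst ennreal_divide_self) auto
  finally show ?thesis .
qed

text \<open>
  On a cube whose centre is close to the origin compared with its edge length, \<open>t\<close> is a radius of a
  ball around the origin that contains the cube. On any other cube \<open>|x|\<close> varies by at most the
  factor \<open>3\<close>, and \<open>t\<close> is comparable with the values of \<open>|x|\<close>. The bounds with the same \<open>t\<close> are what
  makes the powers of \<open>t\<close> cancel in the product that defines the weight constant.
\<close>

lemma cube_averages_infnorm_powr:
  fixes a :: "real ^ 'n"
  assumes "0 < l" "0 \<le> b" "0 < \<delta>" "\<delta> < 1"
  obtains t where "0 < t"
    and "average (cube a l) (\<lambda>x. ennreal (infnorm x powr b)) \<le> ennreal (t powr b)"
    and "average (cube a l) (\<lambda>x. ennreal (infnorm x powr (\<delta> - real CARD('n))))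
      \<le> ennreal (real CARD('n) * 3 ^ CARD('n) / \<delta> * t powr (\<delta> - real CARD('n)))"
proof -
  let ?n = "CARD('n)"
  define h where "h = l / 2"
  define c where "c = (\<chi> i. a $ i + h)"
  have n1: "1 \<le> real ?n" by (simp add: Suc_leI)
  have \<delta>n: "\<delta> \<le> real ?n" using n1 assms by linarith
  have h: "0 < h" using assms by (simp add: h_def)
  have Q: "\<bar>infnorm x - infnorm c\<bar> \<le> h" if "x \<in> cube a l" for x
    using that absdiff_infnorm[of x c] unfolding cube_eq_infnorm_ball c_def h_def by auto
  have upper: "average (cube a l) (\<lambda>x. ennreal (infnorm x powr b)) \<le> ennreal (t powr b)"
    if "\<And>x. x \<in> cube a l \<Longrightarrow> infnorm x \<le> t" for t
    using that assms
    by (intro average_cube_le) (auto intro!: ennreal_leI powr_mono2 infnorm_pos_le)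
  show thesis
  proof (cases "infnorm c \<le> 2 * h")
    case True
    have sub: "infnorm x \<le> 3 * h" if "x \<in> cube a l" for x
      using Q[OF that] True by linarith
    have "(\<integral>\<^sup>+ x\<in>cube a l. ennreal (infnorm x powr (\<delta> - real ?n)) \<partial>lebesgue)
        \<le> (\<integral>\<^sup>+ x\<in>{x :: real ^ 'n. infnorm x \<le> 3 * h}. ennreal (infnorm x powr (\<delta> - real ?n)) \<partial>lebesgue)"
      by (intro nn_integral_mono) (auto simp: indicator_def sub)
    also have "\<dots> = ennreal (real ?n * 2 ^ ?n * ((3 * h) powr \<delta> / \<delta>))"
      using h assms by (intro nn_integral_infnorm_powr) auto
    finally have "average (cube a l) (\<lambda>x. ennreal (infnorm x powr (\<delta> - real ?n)))
        \<le> ennreal (real ?n * 2 ^ ?n * ((3 * h) powr \<delta> / \<delta>)) / ennreal (l ^ ?n)"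
      using assms(1) emeasure_lborel_cube[of l a] unfolding average_def
      by (simp add: cube_def divide_right_mono_ennreal)
    also have "\<dots> = ennreal (real ?n * 2 ^ ?n * ((3 * h) powr \<delta> / \<delta>) / l ^ ?n)"
      using assms by (intro divide_ennreal) auto
    also have "real ?n * 2 ^ ?n * ((3 * h) powr \<delta> / \<delta>) / l ^ ?n
        = real ?n * 3 ^ ?n / \<delta> * (3 * h) powr (\<delta> - real ?n)"
      using h by (simp add: powr_diff powr_realpow h_def power_mult_distrib power_divide)
    finally show thesis
      using upper[OF sub] h by (intro that[of "3 * h"]) auto
  next
    case False
    define m where "m = infnorm c - h"
    have m: "0 < m" "h < m" using False h by (auto simp: m_def)
    have lower: "m \<le> infnorm x" and sub: "infnorm x \<le> 3 * m" if "x \<in> cube a l" for x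
      using Q[OF that] False by (auto simp: m_def)
    have "average (cube a l) (\<lambda>x. ennreal (infnorm x powr (\<delta> - real ?n)))
        \<le> ennreal (m powr (\<delta> - real ?n))"
      using m lower assms \<delta>n
      by (intro average_cube_le ennreal_leI powr_mono2') auto
    also have "m powr (\<delta> - real ?n) \<le> real ?n * 3 ^ ?n / \<delta> * (3 * m) powr (\<delta> - real ?n)"
    proof -
      have "1 * 1 \<le> (real ?n / \<delta>) * 3 powr \<delta>"
        using assms \<delta>n by (intro mult_mono) (auto simp: ge_one_powr_ge_zero)
      also have "\<dots> = real ?n * 3 ^ ?n / \<delta> * 3 powr (\<delta> - real ?n)"
        by (simp add: powr_diff powr_realpow)
      finally have "1 \<le> real ?n * 3 ^ ?n / \<delta> * 3 powr (\<delta> - real ?n)" by simp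
      from mult_right_mono[OF this, of "m powr (\<delta> - real ?n)"] m show ?thesis
        by (simp add: powr_mult mult.assoc)
    qed
    finally show thesis
      using upper[OF sub] m by (intro that[of "3 * m"]) (auto simp: ennreal_leI)
  qed
qed

lemma Aloc_const_infnorm_powr_le:
  fixes p q r \<delta> :: real
  defines "\<kappa> \<equiv> conj_exponent p / q"
  assumes "1 < p" "1 < q" "0 < \<delta>" "\<delta> < 1"
  shows "Aloc_const p q r (\<lambda>x :: real ^ 'n. infnorm x powr ((real CARD('n) - \<delta>) / \<kappa>))
       \<le> ennreal ((real CARD('n) * 3 ^ CARD('n) / \<delta>) powr (1 / \<kappa>))"
  unfolding Aloc_const_def
proof (intro SUP_least, clarify)
  fix a :: "real ^ 'n" and l :: real
  assume "0 < l" "l \<le> r"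
  let ?n = "CARD('n)" and ?b = "(real CARD('n) - \<delta>) / \<kappa>"
  let ?K = "real CARD('n) * 3 ^ CARD('n) / \<delta>"
  have \<kappa>: "0 < \<kappa>" using assms by (simp add: \<kappa>_def conj_exponent_def)
  have n1: "1 \<le> real ?n" by (simp add: Suc_leI)
  then have "\<delta> \<le> real ?n" using assms by linarith
  then have "0 \<le> ?b" using \<kappa> by simp
  from cube_averages_infnorm_powr[OF \<open>0 < l\<close> this \<open>0 < \<delta>\<close> \<open>\<delta> < 1\<close>, of a]
  obtain t where t: "0 < t"
    and 1: "average (cube a l) (\<lambda>x. ennreal (infnorm x powr ?b)) \<le> ennreal (t powr ?b)"
    and 2: "average (cube a l) (\<lambda>x. ennreal (infnorm x powr (\<delta> - real ?n)))
      \<le> ennreal (?K * t powr (\<delta> - real ?n))" .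
  have dual: "(infnorm x powr ?b) powr - \<kappa> = infnorm x powr (\<delta> - real ?n)" for x :: "real ^ 'n"
    using \<kappa> by (simp add: powr_powr)
  have "average (cube a l) (\<lambda>x. ennreal (infnorm x powr ?b)) *
        epowr (average (cube a l) (\<lambda>x. ennreal ((infnorm x powr ?b) powr - \<kappa>))) (1 / \<kappa>)
      \<le> ennreal (t powr ?b) * epowr (ennreal (?K * t powr (\<delta> - real ?n))) (1 / \<kappa>)"
    unfolding dual using 1 2 \<kappa> by (intro mult_mono epowr_mono) auto
  also have "\<dots> = ennreal (t powr ?b * (?K * t powr (\<delta> - real ?n)) powr (1 / \<kappa>))"
    using assms by (subst epowr_ennreal) (auto simp: ennreal_mult'[symmetric])
  also have "t powr ?b * (?K * t powr (\<delta> - real ?n)) powr (1 / \<kappa>) = ?K powr (1 / \<kappa>)"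
  proof -
    have "t powr ?b * t powr ((\<delta> - real ?n) * (1 / \<kappa>)) = 1"
      using t by (simp add: powr_add[symmetric] diff_divide_distrib)
    moreover have "(?K * t powr (\<delta> - real ?n)) powr (1 / \<kappa>)
        = ?K powr (1 / \<kappa>) * t powr ((\<delta> - real ?n) * (1 / \<kappa>))"
      unfolding powr_powr[symmetric] by (rule powr_mult)
    ultimately show ?thesis by (simp only: mult.left_commute[of "t powr ?b"] mult_1_right)
  qed
  finally show "average (cube a l) (\<lambda>x. ennreal (infnorm x powr ?b)) *
        epowr (average (cube a l)
          (\<lambda>x. ennreal ((infnorm x powr ?b) powr - (conj_exponent p / q)))) (q / conj_exponent p)
      \<le> ennreal (?K powr (1 / \<kappa>))"
    by (simp add: \<kappa>_def)
qed

lemma scalar_weight_infnorm_powr: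
  assumes "0 < b"
  shows "scalar_weight (\<lambda>x :: real ^ 'n. infnorm x powr b)"
proof -
  have cont: "continuous_on K (\<lambda>x :: real ^ 'n. infnorm x powr b)" for K
    using assms by (intro continuous_on_powr' continuous_intros) (auto simp: infnorm_pos_le)
  have "set_integrable lebesgue K (\<lambda>x :: real ^ 'n. infnorm x powr b)" if "compact K" for K
    using borel_integrable_compact[OF that cont]
    by (simp add: set_integrable_def integrable_completion borel_measurable_integrable)
  moreover have "AE x in lebesgue. 0 < infnorm (x :: real ^ 'n) powr b"
    by (rule AE_completion, rule AE_mp[OF AE_lborel_singleton[of 0]])
      (auto simp: infnorm_eq_0)
  ultimately show ?thesis
    by (simp add: scalar_weight_def locally_integrable_def)
qed


section \<open>The test function and its maximal function\<close>

lemma weighted_norm_infnorm_powr: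
  fixes p q \<delta> R :: real
  defines "\<kappa> \<equiv> conj_exponent p / q"
  assumes "1 < p" "1 < q" "0 < \<delta>" "0 < R"
  shows "weighted_norm p
           (\<lambda>x :: real ^ 'n. (infnorm x powr ((real CARD('n) - \<delta>) / \<kappa>)) powr (p / q))
           (\<lambda>x. ennreal \<bar>indicator {x. infnorm x \<le> R} x * infnorm x powr (\<delta> - real CARD('n))\<bar>)
       = ennreal ((real CARD('n) * 2 ^ CARD('n) * (R powr \<delta> / \<delta>)) powr (1 / p))"
proof -
  let ?n = "CARD('n)"
  have exponent: "(\<delta> - real ?n) * p + (real ?n - \<delta>) / \<kappa> * (p / q) = \<delta> - real ?n"
  proof -
    have "1 / \<kappa> * (p / q) = p - 1"
      using assms by (simp add: \<kappa>_def conj_exponent_def)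
    then have "(\<delta> - real ?n) * p + (real ?n - \<delta>) * (1 / \<kappa> * (p / q)) = \<delta> - real ?n"
      by (simp only:) (simp add: algebra_simps)
    then show ?thesis by simp
  qed
  have "epowr (ennreal \<bar>indicator {x. infnorm x \<le> R} x * infnorm x powr (\<delta> - real ?n)\<bar>) p
        * ennreal ((infnorm x powr ((real ?n - \<delta>) / \<kappa>)) powr (p / q))
      = ennreal (infnorm x powr (\<delta> - real ?n)) * indicator {x. infnorm x \<le> R} x" for x :: "real ^ 'n"
    using exponent
    by (cases "infnorm x \<le> R")
      (simp_all add: epowr_0 epowr_ennreal powr_powr ennreal_mult'[symmetric] powr_add[symmetric])
  then have "(\<integral>\<^sup>+ x. epowr (ennreal \<bar>indicator {x. infnorm x \<le> R} x * infnorm x powr (\<delta> - real ?n)\<bar>) p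
        * ennreal ((infnorm (x :: real ^ 'n) powr ((real ?n - \<delta>) / \<kappa>)) powr (p / q)) \<partial>lebesgue)
      = ennreal (real ?n * 2 ^ ?n * (R powr \<delta> / \<delta>))"
    using nn_integral_infnorm_powr[OF \<open>0 < R\<close> \<open>0 < \<delta>\<close>] by simp
  then show ?thesis
    unfolding weighted_norm_def using assms by (simp only: epowr_ennreal)
      (subst epowr_ennreal, auto)
qed

lemma loc_frac_maximal_infnorm_powr_ge:
  fixes x :: "real ^ 'n"
  assumes "0 < \<delta>" "0 < r" "infnorm x \<le> r / 2" "x \<noteq> 0"
  shows "ennreal (real CARD('n) * 2 powr \<alpha> / \<delta> * infnorm x powr (\<alpha> - real CARD('n) + \<delta>))
    \<le> loc_frac_maximal \<alpha> r
        (\<lambda>x. indicator {x. infnorm x \<le> r / 2} x * infnorm x powr (\<delta> - real CARD('n))) x"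
proof -
  let ?n = "CARD('n)"
  let ?f = "\<lambda>x :: real ^ 'n. indicator {x. infnorm x \<le> r / 2} x * infnorm x powr (\<delta> - real ?n)"
  define \<rho> where "\<rho> = infnorm x"
  have \<rho>: "0 < \<rho>" "\<rho> \<le> r / 2"
    using assms infnorm_pos_lt by (auto simp: \<rho>_def)
  \<comment> \<open>The smallest cube centred at the origin that contains \<open>x\<close>.\<close>
  define Q :: "(real ^ 'n) set" where "Q = cube (\<chi> i. - \<rho>) (2 * \<rho>)"
  have Q: "Q = {y. infnorm y \<le> \<rho>}"
    by (simp add: Q_def infnorm_ball_eq_cube)
  have "ennreal \<bar>?f y\<bar> * indicator Q y = ennreal (infnorm y powr (\<delta> - real ?n)) * indicator {y. infnorm y \<le> \<rho>} y" for y
    using \<rho> by (auto simp: Q indicator_def)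
  then have "(\<integral>\<^sup>+ y\<in>Q. ennreal \<bar>?f y\<bar> \<partial>lebesgue) = ennreal (real ?n * 2 ^ ?n * (\<rho> powr \<delta> / \<delta>))"
    using nn_integral_infnorm_powr[OF \<open>0 < \<rho>\<close> \<open>0 < \<delta>\<close>] by simp
  moreover have "epowr (emeasure lebesgue Q) (1 - \<alpha> / real ?n) = ennreal ((2 * \<rho>) powr (real ?n - \<alpha>))"
  proof -
    have "emeasure lebesgue Q = ennreal ((2 * \<rho>) ^ ?n)"
      using \<rho> emeasure_lborel_cube[of "2 * \<rho>" "(\<chi> i. - \<rho>) :: real ^ 'n"]
      by (simp add: Q_def cube_def)
    moreover have "((2 * \<rho>) ^ ?n) powr (1 - \<alpha> / real ?n) = (2 * \<rho>) powr (real ?n - \<alpha>)"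
      using \<rho> by (subst powr_realpow[symmetric]) (simp_all only: powr_powr, simp_all add: right_diff_distrib)
    ultimately show ?thesis
      using \<rho> by (subst \<open>emeasure lebesgue Q = _\<close>, subst epowr_ennreal) auto
  qed
  moreover have "real ?n * 2 ^ ?n * (\<rho> powr \<delta> / \<delta>) / (2 * \<rho>) powr (real ?n - \<alpha>)
      = real ?n * 2 powr \<alpha> / \<delta> * \<rho> powr (\<alpha> - real ?n + \<delta>)"
    using \<rho> by (simp add: powr_mult powr_diff powr_add powr_realpow field_simps)
  ultimately have "(\<integral>\<^sup>+ y\<in>Q. ennreal \<bar>?f y\<bar> \<partial>lebesgue) / epowr (emeasure lebesgue Q) (1 - \<alpha> / real ?n)
      = ennreal (real ?n * 2 powr \<alpha> / \<delta> * \<rho> powr (\<alpha> - real ?n + \<delta>))"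
    using \<rho> assms by (simp add: divide_ennreal)
  moreover have "\<dots> = (case ((\<chi> i. - \<rho>), 2 * \<rho>) of (a :: real ^ 'n, l) \<Rightarrow>
      (\<integral>\<^sup>+ y\<in>cube a l. ennreal \<bar>?f y\<bar> \<partial>lebesgue) / epowr (emeasure lebesgue (cube a l)) (1 - \<alpha> / real ?n))"
    using calculation by (simp add: Q_def)
  moreover have "((\<chi> i. - \<rho>), 2 * \<rho>) \<in> {(a, l). 0 < l \<and> l \<le> r \<and> x \<in> cube a l}"
    using \<rho> Q by (simp add: Q_def \<rho>_def)
  ultimately show ?thesis
    unfolding loc_frac_maximal_def \<rho>_def[symmetric]
    by (metis (no_types, lifting) SUP_upper)
qed

lemma weighted_norm_loc_frac_maximal_ge:
  fixes \<alpha> p q r \<delta> :: real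
  defines "\<kappa> \<equiv> conj_exponent p / q"
  assumes "1 < p" "1 < q" "1 / q = 1 / p - \<alpha> / real CARD('n)" "0 < \<delta>" "0 < r"
  shows "ennreal (real CARD('n) * 2 powr \<alpha> / \<delta> *
           (real CARD('n) * 2 ^ CARD('n) * ((r / 2) powr (\<delta> * q / p) / (\<delta> * q / p))) powr (1 / q))
       \<le> weighted_norm q
           (\<lambda>x :: real ^ 'n. infnorm x powr ((real CARD('n) - \<delta>) / \<kappa>))
           (loc_frac_maximal \<alpha> r
              (\<lambda>x. indicator {x. infnorm x \<le> r / 2} x * infnorm x powr (\<delta> - real CARD('n))))"
proof -
  let ?n = "CARD('n)"
  let ?f = "\<lambda>x :: real ^ 'n. indicator {x. infnorm x \<le> r / 2} x * infnorm x powr (\<delta> - real ?n)"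
  let ?w = "\<lambda>x :: real ^ 'n. infnorm x powr ((real ?n - \<delta>) / \<kappa>)"
  let ?A = "real ?n * 2 powr \<alpha> / \<delta>" and ?\<beta> = "\<delta> * q / p"
  let ?B = "real ?n * 2 ^ ?n * ((r / 2) powr ?\<beta> / ?\<beta>)"
  have \<beta>: "0 < ?\<beta>" and r2: "0 < r / 2" using assms by simp_all
  have exponent: "(\<alpha> - real ?n + \<delta>) * q + (real ?n - \<delta>) / \<kappa> = ?\<beta> - real ?n"
  proof -
    have "(\<alpha> - real ?n / p) * q = - real ?n"
    proof -
      have "\<alpha> - real ?n / p = - (real ?n / q)"
        using arg_cong[OF assms(4), of "\<lambda>t. real ?n * t"] by (simp add: right_diff_distrib)
      then show ?thesis using assms by simp
    qed
    moreover have "1 / \<kappa> = q * (1 - 1 / p)"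
      using assms by (simp add: \<kappa>_def conj_exponent_def field_simps)
    then have "(real ?n - \<delta>) / \<kappa> = (real ?n - \<delta>) * (q * (1 - 1 / p))"
      by (metis times_divide_eq_right mult_1_right)
    ultimately show ?thesis
      by (simp add: algebra_simps)
  qed
  have pointwise: "ennreal (?A powr q) * (ennreal (infnorm x powr (?\<beta> - real ?n)) * indicator {x. infnorm x \<le> r / 2} x)
      \<le> epowr (loc_frac_maximal \<alpha> r ?f x) q * ennreal (?w x)" for x
  proof (cases "infnorm x \<le> r / 2 \<and> x \<noteq> 0")
    case True
    have "ennreal (?A powr q) * ennreal (infnorm x powr (?\<beta> - real ?n))
        = ennreal ((?A * infnorm x powr (\<alpha> - real ?n + \<delta>)) powr q) * ennreal (?w x)"
    proof -
      have "(?A * infnorm x powr (\<alpha> - real ?n + \<delta>)) powr q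
          = ?A powr q * infnorm x powr ((\<alpha> - real ?n + \<delta>) * q)"
        unfolding powr_powr[symmetric] by (rule powr_mult)
      then have "(?A * infnorm x powr (\<alpha> - real ?n + \<delta>)) powr q * ?w x
          = ?A powr q * infnorm x powr (?\<beta> - real ?n)"
        by (simp only: mult.assoc powr_add[symmetric] exponent)
      then show ?thesis
        by (simp only: ennreal_mult'[symmetric] powr_ge_zero)
    qed
    also have "\<dots> = epowr (ennreal (?A * infnorm x powr (\<alpha> - real ?n + \<delta>))) q * ennreal (?w x)"
      using assms by (subst epowr_ennreal) auto
    also have "\<dots> \<le> epowr (loc_frac_maximal \<alpha> r ?f x) q * ennreal (?w x)"
      using True assms loc_frac_maximal_infnorm_powr_ge[of \<delta> r x \<alpha>]
      by (intro mult_right_mono epowr_mono) auto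
    finally show ?thesis using True by simp
  qed (auto simp: infnorm_0)
  have "ennreal (?A powr q * ?B) = ennreal (?A powr q) *
      (\<integral>\<^sup>+ x \<in> {x :: real ^ 'n. infnorm x \<le> r / 2}. ennreal (infnorm x powr (?\<beta> - real ?n)) \<partial>lebesgue)"
    unfolding nn_integral_infnorm_powr[OF r2 \<beta>] by (rule ennreal_mult') (rule powr_ge_zero)
  also have "\<dots> = (\<integral>\<^sup>+ x. ennreal (?A powr q) * (ennreal (infnorm x powr (?\<beta> - real ?n))
      * indicator {x :: real ^ 'n. infnorm x \<le> r / 2} x) \<partial>lebesgue)"
    by (simp add: nn_integral_completion nn_integral_cmult)
  also have "\<dots> \<le> (\<integral>\<^sup>+ x. epowr (loc_frac_maximal \<alpha> r ?f x) q * ennreal (?w x) \<partial>lebesgue)"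
    by (intro nn_integral_mono pointwise)
  finally have "epowr (ennreal (?A powr q * ?B)) (1 / q) \<le> weighted_norm q ?w (loc_frac_maximal \<alpha> r ?f)"
    unfolding weighted_norm_def using \<open>1 < q\<close> by (intro epowr_mono) auto
  moreover have "epowr (ennreal (?A powr q * ?B)) (1 / q) = ennreal (?A * ?B powr (1 / q))"
  proof -
    have "(?A powr q) powr (1 / q) = ?A"
      using \<open>1 < q\<close> \<open>0 < \<delta>\<close> by (simp add: powr_powr)
    then have "(?A powr q * ?B) powr (1 / q) = ?A * ?B powr (1 / q)"
      by (simp only: powr_mult)
    then show ?thesis
      using \<open>1 < p\<close> \<open>1 < q\<close> \<open>0 < \<delta>\<close> by (subst epowr_ennreal) auto
  qed
  ultimately show ?thesis by simp
qed

section \<open>Comparison of exponents\<close>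

lemma exponent_le_if_powr_le:
  assumes "\<And>\<delta>. 0 < \<delta> \<Longrightarrow> \<delta> < 1 \<Longrightarrow> c * \<delta> powr - a \<le> d * \<delta> powr - b" and "0 < c"
  shows "a \<le> (b :: real)"
proof (rule ccontr)
  assume "\<not> a \<le> b"
  then have ab: "0 < a - b" by simp
  have bound: "\<delta> powr - (a - b) \<le> d / c" if "0 < \<delta>" "\<delta> < 1" for \<delta>
  proof -
    have "c * \<delta> powr - (a - b) = c * \<delta> powr - a * \<delta> powr b"
      by (simp add: powr_add[symmetric])
    also have "\<dots> \<le> d * \<delta> powr - b * \<delta> powr b"
      using assms(1)[OF that] by (intro mult_right_mono) auto
    also have "\<dots> = d"
      using that by (simp add: mult.assoc powr_add[symmetric])
    finally show ?thesis
      using \<open>0 < c\<close> by (simp add: field_simps)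
  qed
  \<comment> \<open>A number above the bound, and the \<open>\<delta>\<close> at which the left-hand side of \<open>bound\<close> equals it.\<close>
  define T where "T = \<bar>d / c\<bar> + 2"
  define \<delta> where "\<delta> = T powr (- 1 / (a - b))"
  have "1 < T" unfolding T_def using abs_ge_zero[of "d / c"] by linarith
  then have "0 < \<delta>" "\<delta> < 1"
    using ab by (auto simp: \<delta>_def intro!: powr_less_one)
  moreover have "\<delta> powr - (a - b) = T"
  proof -
    have "- 1 / (a - b) * - (a - b) = 1" using ab by (simp add: field_simps)
    then show ?thesis
      using \<open>1 < T\<close> by (simp only: \<delta>_def powr_powr) simp
  qed
  ultimately have "T \<le> d / c" using bound by metis
  then show False unfolding T_def by linarith
qed

theorem proposition4p3:
  fixes \<alpha> p q r s C :: real
  assumes "0 \<le> \<alpha>" and "\<alpha> < real CARD('n::finite)"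
    and "1 < p" and "\<alpha> = 0 \<or> p < real CARD('n) / \<alpha>"
    and "1 < q"
    and "1 / q = 1 / p - \<alpha> / real CARD('n)"
    and "0 < r" and "0 < s" and "0 < C"
    and "\<And>(w :: real ^ 'n \<Rightarrow> real) f.
           w \<in> Aloc p q r \<Longrightarrow> f \<in> weighted_Lp p (\<lambda>x. w x powr (p / q)) \<Longrightarrow>
           weighted_norm q w (loc_frac_maximal \<alpha> r f)
             \<le> ennreal C * epowr (Aloc_const p q r w) s *
                weighted_norm p (\<lambda>x. w x powr (p / q)) (\<lambda>x. ennreal \<bar>f x\<bar>)"
  shows "s \<ge> (1 - \<alpha> / real CARD('n)) * (conj_exponent p / q)"
proof -
  let ?n = "CARD('n)"
  define \<kappa> where "\<kappa> = conj_exponent p / q"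
  define R where "R = r / 2"
  have \<kappa>: "0 < \<kappa>" using assms by (simp add: \<kappa>_def conj_exponent_def)
  have R: "0 < R" using assms by (simp add: R_def)
  \<comment> \<open>The parts of the two sides of the tested inequality that do not depend on \<open>\<delta>\<close>.\<close>
  define X where "X = real ?n * 2 powr \<alpha> * (real ?n * 2 ^ ?n * p / q) powr (1 / q)"
  define Y where "Y = C * (real ?n * 3 ^ ?n) powr (s / \<kappa>) * (real ?n * 2 ^ ?n) powr (1 / p)"
  have "0 < X" using assms by (simp add: X_def)
  have "X * \<delta> powr - (1 + 1 / q) \<le> Y * \<delta> powr - (s / \<kappa> + 1 / p)" if \<delta>: "0 < \<delta>" "\<delta> < 1" for \<delta>
  proof -
    let ?w = "\<lambda>x :: real ^ 'n. infnorm x powr ((real ?n - \<delta>) / \<kappa>)"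
    let ?f = "\<lambda>x :: real ^ 'n. indicator {x. infnorm x \<le> R} x * infnorm x powr (\<delta> - real ?n)"
    let ?K = "real ?n * 3 ^ ?n / \<delta>" and ?I = "real ?n * 2 ^ ?n * (R powr \<delta> / \<delta>)"
    have "1 \<le> real ?n" by (simp add: Suc_leI)
    then have "\<delta> < real ?n" using \<delta> by linarith
    then have "0 < (real ?n - \<delta>) / \<kappa>" using \<kappa> by simp
    note weight = scalar_weight_infnorm_powr[OF this]
    note const = Aloc_const_infnorm_powr_le[OF \<open>1 < p\<close> \<open>1 < q\<close> \<delta>, of r, where 'n = 'n, folded \<kappa>_def]
    note norm_f = weighted_norm_infnorm_powr[OF \<open>1 < p\<close> \<open>1 < q\<close> \<delta>(1) R, where 'n = 'n, folded \<kappa>_def]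
    note norm_Mf = weighted_norm_loc_frac_maximal_ge[OF \<open>1 < p\<close> \<open>1 < q\<close> assms(6) \<delta>(1) \<open>0 < r\<close>,
        folded \<kappa>_def R_def]
    have "?w \<in> Aloc p q r"
      using weight const by (auto simp: Aloc_def intro: le_less_trans)
    moreover have "?f \<in> weighted_Lp p (\<lambda>x. ?w x powr (p / q))"
      unfolding weighted_Lp_def mem_Collect_eq norm_f
      by (auto intro!: measurable_completion)
    ultimately have "weighted_norm q ?w (loc_frac_maximal \<alpha> r ?f)
        \<le> ennreal C * epowr (Aloc_const p q r ?w) s
          * weighted_norm p (\<lambda>x. ?w x powr (p / q)) (\<lambda>x. ennreal \<bar>?f x\<bar>)"
      by (rule assms(10))
    also have "\<dots> \<le> ennreal C * epowr (ennreal (?K powr (1 / \<kappa>))) s * ennreal (?I powr (1 / p))"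
      unfolding norm_f using const \<open>0 < s\<close> by (intro mult_right_mono mult_left_mono epowr_mono) auto
    also have "\<dots> = ennreal (C * (?K powr (1 / \<kappa>)) powr s * ?I powr (1 / p))"
      using \<open>0 < C\<close> by (subst epowr_ennreal) (auto simp: ennreal_mult')
    finally have "ennreal (real ?n * 2 powr \<alpha> / \<delta> *
           (real ?n * 2 ^ ?n * (R powr (\<delta> * q / p) / (\<delta> * q / p))) powr (1 / q))
        \<le> ennreal (C * (?K powr (1 / \<kappa>)) powr s * ?I powr (1 / p))"
      using norm_Mf by (rule order_trans[rotated])
    then have "real ?n * 2 powr \<alpha> / \<delta> *
           (real ?n * 2 ^ ?n * (R powr (\<delta> * q / p) / (\<delta> * q / p))) powr (1 / q)
        \<le> C * (?K powr (1 / \<kappa>)) powr s * ?I powr (1 / p)"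
      using \<open>0 < C\<close> by (subst (asm) ennreal_le_iff) auto
    moreover have "real ?n * 2 powr \<alpha> / \<delta> *
           (real ?n * 2 ^ ?n * (R powr (\<delta> * q / p) / (\<delta> * q / p))) powr (1 / q)
        = X * \<delta> powr - (1 + 1 / q) * R powr (\<delta> / p)"
    proof -
      have "real ?n * 2 ^ ?n * (R powr (\<delta> * q / p) / (\<delta> * q / p))
          = (real ?n * 2 ^ ?n * p / q) * R powr (\<delta> * q / p) * \<delta> powr - 1"
        using \<delta> assms by (simp add: powr_minus divide_simps)
      moreover have "1 / \<delta> = \<delta> powr - 1"
        using \<delta> by (simp add: powr_minus divide_simps)
      then have "real ?n * 2 powr \<alpha> / \<delta> = real ?n * 2 powr \<alpha> * \<delta> powr - 1"
        by (metis times_divide_eq_right mult_1_right)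
      moreover have "(R powr (\<delta> * q / p)) powr (1 / q) = R powr (\<delta> / p)"
        using \<open>1 < q\<close> by (simp add: powr_powr)
      moreover have "\<delta> powr - (1 + 1 / q) = \<delta> powr - 1 * (\<delta> powr - 1) powr (1 / q)"
        by (simp only: powr_powr powr_add[symmetric]) simp
      ultimately show ?thesis
        by (simp only: X_def powr_mult mult_ac)
    qed
    moreover have "C * (?K powr (1 / \<kappa>)) powr s * ?I powr (1 / p)
        = Y * \<delta> powr - (s / \<kappa> + 1 / p) * R powr (\<delta> / p)"
    proof -
      have "?K = (real ?n * 3 ^ ?n) * \<delta> powr - 1" "?I = (real ?n * 2 ^ ?n) * R powr \<delta> * \<delta> powr - 1"
        using \<delta> by (simp_all add: powr_minus divide_simps)
      moreover have "\<delta> powr - (s / \<kappa> + 1 / p) = (\<delta> powr - 1) powr (s / \<kappa>) * (\<delta> powr - 1) powr (1 / p)"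
        by (simp only: powr_powr powr_add[symmetric]) simp
      moreover have "(R powr \<delta>) powr (1 / p) = R powr (\<delta> / p)"
        by (simp add: powr_powr)
      moreover have "(z powr (1 / \<kappa>)) powr s = z powr (s / \<kappa>)" for z :: real
        by (simp add: powr_powr)
      ultimately show ?thesis
        by (simp only: Y_def powr_mult mult_ac)
    qed
    ultimately have "X * \<delta> powr - (1 + 1 / q) * R powr (\<delta> / p)
        \<le> Y * \<delta> powr - (s / \<kappa> + 1 / p) * R powr (\<delta> / p)" by simp
    then show ?thesis using R by simp
  qed
  from exponent_le_if_powr_le[OF this \<open>0 < X\<close>]
  have "1 + 1 / q \<le> s / \<kappa> + 1 / p" .
  then have "1 - \<alpha> / real ?n \<le> s / \<kappa>" using assms(6) by linarith
  then show ?thesis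
    using \<kappa> by (simp add: \<kappa>_def[symmetric] pos_le_divide_eq)
qed

end
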